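(* For $\sigma>0$ and any point $(x,y)$ in the quotient triangle $\mathrm{QT}=\{(x,y)\in\mathbb{R}^2\mid 0\leq x<1,\ 0\leq y\leq1,\ x+y\leq1\}$, there is a unique (up to isometry) lattice $\Lambda\subset\mathbb{R}^2$ with the projected invariant $\mathrm{PI}(\Lambda)=(x,y)$ and size $\sigma=r_{12}+r_{01}+r_{02}$. Then $$\mathrm{RI}(\Lambda)=(r_{12},r_{01},r_{02})=\left(\frac{\sigma}{3}y,\ \frac{\sigma}{6}(3-3x-y),\ \frac{\sigma}{6}(3+3x-y)\right).$$ If $(x,y)$ is in the interior of $\mathrm{QT}$, the invariant $\mathrm{RI}$ defines a pair of lattices $\Lambda^{\pm}$ that have opposite signs and unique (up to isometry) reduced basis vectors $v_1,v_2$ with the lengths $|v_1|=\sqrt{r_{12}^2+r_{01}^2}$, $|v_2|=\sqrt{r_{12}^2+r_{02}^2}$ and the anticlockwise angle $$\angle(v_1,v_2)=\arccos\frac{-4y^2}{\sqrt{(9x^2+5y^2-6y+9)^2-36x^2(3-y)^2}}.$$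
   Context: A lattice $\Lambda\subset\mathbb{R}^2$ is the set of all integer linear combinations of a linear basis. A superbase of $\Lambda$ is a triple $\{v_0,v_1,v_2\}$, where $v_1,v_2$ is a basis generating $\Lambda$ and $v_0=-v_1-v_2$; it is obtuse if all $p_{ij}=-v_i\cdot v_j\geq 0$ for $i\neq j$. Every lattice in $\mathbb{R}^2$ has an obtuse superbase. The root invariant $\mathrm{RI}(\Lambda)=(r_{12},r_{01},r_{02})$, $r_{12}\leq r_{01}\leq r_{02}$, is the triple of root products $\sqrt{p_{ij}}$ of an obtuse superbase in increasing order (independent of the choice of obtuse superbase). The size of $\Lambda$ is $r_{12}+r_{01}+r_{02}$. With $\bar r_{ij}=r_{ij}/(r_{12}+r_{01}+r_{02})$, the projected invariant is $\mathrm{PI}(\Lambda)=(\bar r_{02}-\bar r_{01},\,3\bar r_{12})$. $\mathrm{sign}(\Lambda)=0$ if $\Lambda$ is mapped to itself by a reflection in a line; otherwise the vectors of an obtuse superbase have distinct lengths and $\mathrm{sign}(\Lambda)=\pm1$ is the sign of $\det(v_1,v_2)$ for the two shortest ones, $|v_1|<|v_2|$. A basis $v_1,v_2$ of $\Lambda$ is reduced (up to isometry) if $|v_1|\leq|v_2|$ and $-\frac12 v_1^2\leq v_1\cdot v_2\leq0$. The anticlockwise angle $\angle(v_1,v_2)$ is measured from $v_1$ to $v_2$ in the anticlockwise direction around the origin.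
   Formalization: The anticlockwise angle equals the stated arccos only for the lattice of positive sign; for the lattice of negative sign, whose reduced basis is the mirror image, the anticlockwise angle is 2π minus that arccos. *)

theory Defs
  imports "HOL-Analysis.Analysis"
begin

type_synonym plane = "real ^ 2"

definition lattice_basis :: "plane set \<Rightarrow> plane \<Rightarrow> plane \<Rightarrow> bool" where
  "lattice_basis L v1 v2 \<longleftrightarrow>
     independent {v1, v2} \<and> span {v1, v2} = UNIV \<and>
     L = {of_int a *\<^sub>R v1 + of_int b *\<^sub>R v2 | a b :: int. True}"

definition is_lattice :: "plane set \<Rightarrow> bool" where
  "is_lattice L \<longleftrightarrow> (\<exists>v1 v2. lattice_basis L v1 v2)"

text \<open>A superbase is an unordered triple in the paper. Here it carries a labelling; every
  permutation of the labels of an obtuse superbase gives again an obtuse superbase.\<close>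

definition obtuse_superbase :: "plane set \<Rightarrow> plane \<Rightarrow> plane \<Rightarrow> plane \<Rightarrow> bool" where
  "obtuse_superbase L v0 v1 v2 \<longleftrightarrow>
     lattice_basis L v1 v2 \<and> v0 = - v1 - v2 \<and>
     - (v0 \<bullet> v1) \<ge> 0 \<and> - (v0 \<bullet> v2) \<ge> 0 \<and> - (v1 \<bullet> v2) \<ge> 0"

definition root_product :: "plane \<Rightarrow> plane \<Rightarrow> real" where
  "root_product v w = sqrt (- (v \<bullet> w))"

text \<open>The triple \<open>(r12, r01, r02)\<close>. The increasing order is obtained by choosing a labelling of
  an obtuse superbase; the resulting triple depends neither on the obtuse superbase nor on
  the labelling.\<close>

definition root_invariant :: "plane set \<Rightarrow> real \<times> real \<times> real" where
  "root_invariant L =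
     (THE r. \<exists>v0 v1 v2. obtuse_superbase L v0 v1 v2 \<and>
        r = (root_product v1 v2, root_product v0 v1, root_product v0 v2) \<and>
        root_product v1 v2 \<le> root_product v0 v1 \<and>
        root_product v0 v1 \<le> root_product v0 v2)"

definition lattice_size :: "plane set \<Rightarrow> real" where
  "lattice_size L = (case root_invariant L of (r12, r01, r02) \<Rightarrow> r12 + r01 + r02)"

definition projected_invariant :: "plane set \<Rightarrow> real \<times> real" where
  "projected_invariant L = (case root_invariant L of (r12, r01, r02) \<Rightarrow>
     (r02 / lattice_size L - r01 / lattice_size L, 3 * (r12 / lattice_size L)))"

definition quotient_triangle :: "(real \<times> real) set" where
  "quotient_triangle = {(x, y). 0 \<le> x \<and> x < 1 \<and> 0 \<le> y \<and> y \<le> 1 \<and> x + y \<le> 1}"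

text \<open>Reflection in the line through \<open>p\<close> with normal vector \<open>u \<noteq> 0\<close>.\<close>

definition line_reflection :: "plane \<Rightarrow> plane \<Rightarrow> plane \<Rightarrow> plane" where
  "line_reflection p u z = z - (2 * ((z - p) \<bullet> u) / (u \<bullet> u)) *\<^sub>R u"

definition lattice_sign :: "plane set \<Rightarrow> real" where
  "lattice_sign L =
     (if \<exists>p u. u \<noteq> 0 \<and> line_reflection p u ` L = L then 0
      else THE s. \<exists>v0 v1 v2. obtuse_superbase L v0 v1 v2 \<and>
             norm v1 < norm v2 \<and> norm v2 < norm v0 \<and>
             s = sgn (det (vector [v1, v2] :: real ^ 2 ^ 2)))"

definition reduced_basis :: "plane set \<Rightarrow> plane \<Rightarrow> plane \<Rightarrow> bool" where
  "reduced_basis L v1 v2 \<longleftrightarrow>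
     lattice_basis L v1 v2 \<and> norm v1 \<le> norm v2 \<and>
     - (1/2) * (v1 \<bullet> v1) \<le> v1 \<bullet> v2 \<and> v1 \<bullet> v2 \<le> 0"

definition isometric :: "plane set \<Rightarrow> plane set \<Rightarrow> bool" where
  "isometric L L' \<longleftrightarrow> (\<exists>f. (\<forall>p q. dist (f p) (f q) = dist p q) \<and> f ` L = L')"

definition rigidly_equivalent :: "plane set \<Rightarrow> plane set \<Rightarrow> bool" where
  "rigidly_equivalent L L' \<longleftrightarrow>
     (\<exists>(A :: real ^ 2 ^ 2) t. rotation_matrix A \<and> (\<lambda>z. A *v z + t) ` L = L')"

text \<open>Vectors are taken at the origin, so isometries of ordered bases are linear.\<close>

definition isometric_bases :: "plane \<Rightarrow> plane \<Rightarrow> plane \<Rightarrow> plane \<Rightarrow> bool" where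
  "isometric_bases v1 v2 w1 w2 \<longleftrightarrow>
     (\<exists>f. orthogonal_transformation f \<and> f v1 = w1 \<and> f v2 = w2)"

text \<open>The anticlockwise angle from \<open>v\<close> to \<open>w\<close>, with values in \<open>[0, 2 * pi)\<close>.\<close>

definition anticlockwise_angle :: "plane \<Rightarrow> plane \<Rightarrow> real" where
  "anticlockwise_angle v w = Arg2pi (Complex (w $ 1) (w $ 2) / Complex (v $ 1) (v $ 2))"

end

theory Submission
  imports Defs
begin

text \<open>Label an obtuse superbase so that \<open>p = r12\<^sup>2 \<le> q = r01\<^sup>2 \<le> r = r02\<^sup>2\<close>.  By Selling's formula
  the squared length of \<open>a v1 + b v2\<close> is \<open>p (a - b)\<^sup>2 + q a\<^sup>2 + r b\<^sup>2\<close>, so \<open>p + q\<close> and \<open>p + r\<close> are the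
  squared successive minima of the lattice.  Together with the covolume they determine
  \<open>p, q, r\<close>, hence the Gram matrix and the lattice up to isometry.  When \<open>0 < p < q < r\<close> the minima
  are attained only at \<open>\<plusminus>v1\<close> and \<open>\<plusminus>v2\<close>, so the superbase is unique up to a common sign.  This
  excludes reflections, makes the sign of the determinant an invariant of the lattice and
  identifies the reduced bases.\<close>

subsection \<open>Determinants and bases of planar lattices\<close>


text \<open>Oriented area. Its nonvanishing replaces independence together with spanning; for a
  lattice basis its absolute value is the covolume and its sign the orientation.\<close>

definition cross2 :: "plane \<Rightarrow> plane \<Rightarrow> real" where
  "cross2 v w = v $ 1 * w $ 2 - v $ 2 * w $ 1"

lemma inner_plane: "v \<bullet> w = v $ 1 * w $ 1 + v $ 2 * w $ 2" for v w :: plane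
  by (simp add: inner_vec_def sum_2)

lemma det_vector_cross2: "det (vector [v, w] :: real ^ 2 ^ 2) = cross2 v w"
  by (simp add: det_2 cross2_def algebra_simps)

lemma cross2_comb:
  "cross2 (a *\<^sub>R v + b *\<^sub>R w) (c *\<^sub>R v + d *\<^sub>R w) = (a * d - b * c) * cross2 v w"
  by (simp add: cross2_def algebra_simps)

text \<open>Lagrange's identity: the squared area is the Gram determinant, so inner products fix the
  area up to sign.\<close>

lemma cross2_square: "(cross2 v w)\<^sup>2 = (v \<bullet> v) * (w \<bullet> w) - (v \<bullet> w)\<^sup>2"
  by (simp add: cross2_def inner_plane algebra_simps power2_eq_square)

lemma cross2_bound: "\<bar>cross2 v w\<bar> \<le> norm v * norm w"
proof -
  have "(cross2 v w)\<^sup>2 \<le> (norm v * norm w)\<^sup>2"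
    by (simp add: cross2_square power_mult_distrib dot_square_norm)
  then show ?thesis
    by (metis abs_le_square_iff abs_of_nonneg mult_nonneg_nonneg norm_ge_zero)
qed

text \<open>Cramer's rule.\<close>

lemma cross2_decompose:
  assumes "cross2 v w \<noteq> 0"
  shows "z = (cross2 z w / cross2 v w) *\<^sub>R v + (cross2 v z / cross2 v w) *\<^sub>R w"
proof -
  have "cross2 v w * z $ i = cross2 z w * v $ i + cross2 v z * w $ i" for i
    using exhaust_2[of i] by (auto simp: cross2_def algebra_simps)
  then have "z $ i = cross2 z w / cross2 v w * v $ i + cross2 v z / cross2 v w * w $ i" for i
    using assms by (simp add: field_simps)
  then show ?thesis
    by (simp add: vec_eq_iff)
qed

text \<open>Spanning writes the two unit vectors, which enclose area 1, as combinations of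
  \<open>v\<close> and \<open>w\<close>, so \<open>cross2 v w\<close> cannot vanish; this also rules
  out \<open>v = w\<close>. The converse is Cramer's rule.\<close>

lemma lattice_basis_iff:
  "lattice_basis L v w \<longleftrightarrow>
     cross2 v w \<noteq> 0 \<and> L = {of_int a *\<^sub>R v + of_int b *\<^sub>R w | a b :: int. True}"
proof -
  have "independent {v, w} \<and> span {v, w} = UNIV \<longleftrightarrow> cross2 v w \<noteq> 0"
  proof
    assume span: "independent {v, w} \<and> span {v, w} = UNIV"
    have comb: "\<exists>a b. z = a *\<^sub>R v + b *\<^sub>R w" for z
    proof -
      have "z \<in> span {v, w}"
        using span by simp
      then obtain a where "z - a *\<^sub>R v \<in> span {w}"
        by (auto simp: span_insert)
      then obtain b where "z - a *\<^sub>R v = b *\<^sub>R w"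
        by (auto simp: span_singleton)
      then have "z = a *\<^sub>R v + b *\<^sub>R w"
        by (simp add: algebra_simps)
      then show ?thesis by blast
    qed
    obtain a b where e1: "axis 1 1 = a *\<^sub>R v + b *\<^sub>R w"
      using comb by blast
    obtain c d where e2: "axis 2 1 = c *\<^sub>R v + d *\<^sub>R w"
      using comb by blast
    have "cross2 (axis 1 1) (axis 2 1) = 1"
      by (simp add: cross2_def axis_def)
    then show "cross2 v w \<noteq> 0"
      unfolding e1 e2 cross2_comb by auto
  next
    assume nz: "cross2 v w \<noteq> 0"
    have "z \<in> span {v, w}" for z
      by (subst cross2_decompose[OF nz, of z])
        (intro span_add span_scale span_base; simp)
    moreover have "v \<notin> span {w}" "w \<noteq> 0"
      using nz by (auto simp: span_singleton cross2_def)
    ultimately show "independent {v, w} \<and> span {v, w} = UNIV"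
      by (auto simp: independent_insert)
  qed
  then show ?thesis
    by (auto simp: lattice_basis_def)
qed

lemma lattice_basis_cross2: "lattice_basis L v w \<Longrightarrow> cross2 v w \<noteq> 0"
  by (simp add: lattice_basis_iff)

lemma lattice_basis_mem:
  "lattice_basis L v w \<Longrightarrow> z \<in> L \<longleftrightarrow> (\<exists>a b :: int. z = of_int a *\<^sub>R v + of_int b *\<^sub>R w)"
  by (auto simp: lattice_basis_iff)

lemma lattice_basis_in:
  assumes "lattice_basis L v w"
  shows "v \<in> L" "w \<in> L"
proof -
  have "v = of_int 1 *\<^sub>R v + of_int 0 *\<^sub>R w" "w = of_int 0 *\<^sub>R v + of_int 1 *\<^sub>R w"
    by simp_all
  then show "v \<in> L" "w \<in> L"
    using lattice_basis_mem[OF assms] by blast+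
qed

lemma lattice_basis_diff:
  assumes "lattice_basis L v w" "z \<in> L" "z' \<in> L"
  shows "z - z' \<in> L"
proof -
  obtain a b c d :: int where "z = of_int a *\<^sub>R v + of_int b *\<^sub>R w" "z' = of_int c *\<^sub>R v + of_int d *\<^sub>R w"
    using assms lattice_basis_mem by blast
  then have "z - z' = of_int (a - c) *\<^sub>R v + of_int (b - d) *\<^sub>R w"
    by (simp add: algebra_simps)
  then show ?thesis
    using assms lattice_basis_mem by blast
qed

lemma lattice_basis_unimodular:
  assumes basis: "lattice_basis L v w" and unit: "a * d - b * c = 1 \<or> a * d - b * c = (-1 :: int)"
  shows "lattice_basis L (of_int a *\<^sub>R v + of_int b *\<^sub>R w) (of_int c *\<^sub>R v + of_int d *\<^sub>R w)"
    (is "lattice_basis L ?v ?w")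
proof -
  define e where "e = a * d - b * c"
  have e: "e * e = 1"
    using unit by (auto simp: e_def)
  have "cross2 ?v ?w = of_int e * cross2 v w"
    by (simp add: cross2_comb e_def)
  then have "cross2 ?v ?w \<noteq> 0"
    using lattice_basis_cross2[OF basis] e by auto
  moreover have "z \<in> L \<longleftrightarrow> (\<exists>m n :: int. z = of_int m *\<^sub>R ?v + of_int n *\<^sub>R ?w)" for z
  proof
    assume "z \<in> L"
    then obtain m n :: int where z: "z = of_int m *\<^sub>R v + of_int n *\<^sub>R w"
      using lattice_basis_mem[OF basis] by blast
    \<comment> \<open>Coordinates under the inverse matrix: the adjugate times \<open>e\<close>,
      because a determinant of 1 or -1 is its own inverse.\<close>
    define m' n' where "m' = e * (d * m - c * n)" "n' = e * (a * n - b * m)"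
    have "m' * a + n' * c = e * e * m" "m' * b + n' * d = e * e * n"
      unfolding m'_n'_def by (simp_all add: e_def algebra_simps)
    then have mn: "m' * a + n' * c = m" "m' * b + n' * d = n"
      using e by simp_all
    have "z = of_int m' *\<^sub>R ?v + of_int n' *\<^sub>R ?w"
      unfolding z mn[symmetric] by (simp add: algebra_simps)
    then show "\<exists>m n :: int. z = of_int m *\<^sub>R ?v + of_int n *\<^sub>R ?w"
      by blast
  next
    assume "\<exists>m n :: int. z = of_int m *\<^sub>R ?v + of_int n *\<^sub>R ?w"
    then obtain m n :: int where "z = of_int m *\<^sub>R ?v + of_int n *\<^sub>R ?w"
      by blast
    then have "z = of_int (m * a + n * c) *\<^sub>R v + of_int (m * b + n * d) *\<^sub>R w"
      by (simp add: algebra_simps)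
    then show "z \<in> L"
      using lattice_basis_mem[OF basis] by blast
  qed
  ultimately show ?thesis
    by (auto simp: lattice_basis_iff)
qed

lemma lattice_basis_swap: "lattice_basis L v w \<Longrightarrow> lattice_basis L w v"
  using lattice_basis_unimodular[of L v w 0 0 1 1] by simp

lemma lattice_basis_uminus_right: "lattice_basis L v w \<Longrightarrow> lattice_basis L v (- w)"
  using lattice_basis_unimodular[of L v w 1 "-1" 0 0] by simp

lemma lattice_basis_third: "lattice_basis L v w \<Longrightarrow> lattice_basis L (- v - w) v"
  using lattice_basis_unimodular[of L v w "-1" 0 "-1" 1] by simp

text \<open>The determinant of a change of basis is a nonzero integer, so the squared area cannot
  decrease; exchanging the two bases gives equality.\<close>

lemma lattice_basis_cross2_square:
  assumes "lattice_basis L v w" "lattice_basis L v' w'"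
  shows "(cross2 v w)\<^sup>2 = (cross2 v' w')\<^sup>2"
proof -
  have le: "(cross2 v w)\<^sup>2 \<le> (cross2 v' w')\<^sup>2"
    if basis: "lattice_basis L v w" and basis': "lattice_basis L v' w'" for v w v' w'
  proof -
    obtain a b c d :: int where vw: "v' = of_int a *\<^sub>R v + of_int b *\<^sub>R w" "w' = of_int c *\<^sub>R v + of_int d *\<^sub>R w"
      using lattice_basis_mem[OF basis] lattice_basis_in[OF basis'] by auto
    have eq: "cross2 v' w' = of_int (a * d - b * c) * cross2 v w"
      by (simp add: vw cross2_comb)
    then have "a * d - b * c \<noteq> 0"
      using lattice_basis_cross2[OF basis'] by (metis mult_zero_left of_int_0)
    then have "1 \<le> (a * d - b * c)\<^sup>2"
      by (smt (verit) zero_less_power2)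
    then have "1 \<le> (of_int (a * d - b * c) :: real)\<^sup>2"
      by (metis of_int_1_le_iff of_int_power)
    then have "1 * (cross2 v w)\<^sup>2 \<le> (of_int (a * d - b * c))\<^sup>2 * (cross2 v w)\<^sup>2"
      by (intro mult_right_mono) auto
    then show ?thesis
      by (simp add: eq power_mult_distrib)
  qed
  show ?thesis
    using le[OF assms] le[OF assms(2,1)] by simp
qed


section \<open>Discreteness of lattices\<close>

text \<open>By Cramer's rule each integer coordinate of \<open>z\<close>, times the covolume, is an
  area spanned by \<open>z\<close> and a basis vector, hence bounded on the ball.\<close>

lemma finite_lattice_ball:
  assumes basis: "lattice_basis L v w"
  shows "finite {z \<in> L. norm z \<le> R}"
proof -
  define D where "D = \<bar>cross2 v w\<bar>"
  have D: "D > 0"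
    using lattice_basis_cross2[OF basis] by (simp add: D_def)
  define M where "M = \<lceil>R * (norm v + norm w) / D\<rceil>"
  have bound: "a \<in> {-M..M}" if "\<bar>of_int a\<bar> * D \<le> norm z * norm u" "norm z \<le> R" "u \<in> {v, w}"
    for a :: int and z u
  proof -
    have "\<bar>of_int a\<bar> * D \<le> R * (norm v + norm w)"
      using that(2,3) order.trans[OF norm_ge_zero that(2)]
      by (intro order.trans[OF that(1)] mult_mono) auto
    then have "\<bar>of_int a\<bar> \<le> R * (norm v + norm w) / D"
      using D by (simp add: field_simps)
    then have "\<bar>of_int a\<bar> \<le> real_of_int M"
      unfolding M_def by linarith
    then show ?thesis
      by auto
  qed
  have "{z \<in> L. norm z \<le> R} \<subseteq> (\<lambda>(a, b). of_int a *\<^sub>R v + of_int b *\<^sub>R w) ` ({-M..M} \<times> {-M..M})"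
  proof
    fix z assume z: "z \<in> {z \<in> L. norm z \<le> R}"
    then obtain a b :: int where ab: "z = of_int a *\<^sub>R v + of_int b *\<^sub>R w"
      using lattice_basis_mem[OF basis] by blast
    have "cross2 z w = of_int a * cross2 v w" "cross2 v z = of_int b * cross2 v w"
      by (simp_all add: ab cross2_def algebra_simps)
    then have "\<bar>of_int a\<bar> * D \<le> norm z * norm w" "\<bar>of_int b\<bar> * D \<le> norm z * norm v"
      using cross2_bound[of z w] cross2_bound[of v z]
      by (simp_all add: D_def abs_mult mult.commute)
    then have "a \<in> {-M..M}" "b \<in> {-M..M}"
      using bound z by blast+
    then show "z \<in> (\<lambda>(a, b). of_int a *\<^sub>R v + of_int b *\<^sub>R w) ` ({-M..M} \<times> {-M..M})"
      using ab by force
  qed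
  then show ?thesis
    by (rule finite_subset) simp
qed

subsection \<open>Obtuse superbases\<close>

text \<open>The sum of the squared lengths of the superbase \<open>v\<close>, \<open>w\<close>,
  \<open>- v - w\<close>, which Selling's reduction decreases step by step.\<close>

definition superbase_energy :: "plane \<Rightarrow> plane \<Rightarrow> real" where
  "superbase_energy v w = v \<bullet> v + w \<bullet> w + (v + w) \<bullet> (v + w)"

text \<open>The energy bounds the lengths of both basis vectors, so only finitely many bases have
  energy at most that of a given one. A minimum among these is a minimum among all bases.\<close>

lemma minimal_superbase:
  assumes "is_lattice L"
  obtains v w where "lattice_basis L v w"
    "\<And>v' w'. lattice_basis L v' w' \<Longrightarrow> superbase_energy v w \<le> superbase_energy v' w'"
proof -
  obtain v0 w0 where basis: "lattice_basis L v0 w0"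
    using assms by (auto simp: is_lattice_def)
  define K where "K = superbase_energy v0 w0"
  define S where "S = {(v, w). lattice_basis L v w \<and> superbase_energy v w \<le> K}"
  have "v \<bullet> v \<le> superbase_energy v w" "w \<bullet> w \<le> superbase_energy v w" for v w
    unfolding superbase_energy_def by simp_all
  then have "S \<subseteq> {z \<in> L. norm z \<le> sqrt K} \<times> {z \<in> L. norm z \<le> sqrt K}"
    using order.trans by (fastforce simp: S_def norm_eq_sqrt_inner lattice_basis_in)
  then have fin: "finite S"
    by (rule finite_subset) (simp add: finite_lattice_ball[OF basis])
  have ne: "S \<noteq> {}"
    using basis by (auto simp: S_def K_def)
  obtain x where x: "x \<in> S" "\<not> (\<exists>y\<in>S. case_prod superbase_energy y < case_prod superbase_energy x)"
    using arg_min_if_finite[OF fin ne] by blast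
  define v w where "v = fst x" "w = snd x"
  have vw: "(v, w) \<in> S"
    and min: "\<And>v' w'. (v', w') \<in> S \<Longrightarrow> superbase_energy v w \<le> superbase_energy v' w'"
    using x by (force simp: v_w_def case_prod_beta not_less)+
  show thesis
  proof (rule that)
    show "lattice_basis L v w"
      using vw by (simp add: S_def)
    show "superbase_energy v w \<le> superbase_energy v' w'" if "lattice_basis L v' w'" for v' w'
      using that vw min[of v' w'] by (cases "superbase_energy v' w' \<le> K") (simp_all add: S_def)
  qed
qed

text \<open>With \<open>v0 = - v - w\<close>, the parameters \<open>p\<close>, \<open>q\<close>, \<open>r\<close> are the products \<open>- v \<bullet> w\<close>,
  \<open>- v0 \<bullet> v\<close>, \<open>- v0 \<bullet> w\<close>, so \<open>v\<close> and \<open>w\<close> are two shortest vectors of the superbase.\<close>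

definition sorted_superbase :: "plane set \<Rightarrow> plane \<Rightarrow> plane \<Rightarrow> real \<Rightarrow> real \<Rightarrow> real \<Rightarrow> bool" where
  "sorted_superbase L v w p q r \<longleftrightarrow>
     lattice_basis L v w \<and> v \<bullet> w = - p \<and> v \<bullet> v = p + q \<and> w \<bullet> w = p + r \<and>
     0 \<le> p \<and> p \<le> q \<and> q \<le> r"

lemma obtuse_superbase_swap: "obtuse_superbase L v0 v1 v2 \<Longrightarrow> obtuse_superbase L v0 v2 v1"
  by (auto simp: obtuse_superbase_def inner_commute dest: lattice_basis_swap)

lemma obtuse_superbase_rotate: "obtuse_superbase L v0 v1 v2 \<Longrightarrow> obtuse_superbase L v2 v0 v1"
  by (auto simp: obtuse_superbase_def inner_commute dest: lattice_basis_third)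

lemma obtuse_superbase_exists:
  assumes "is_lattice L"
  obtains v0 v1 v2 where "obtuse_superbase L v0 v1 v2"
proof -
  obtain v w where basis: "lattice_basis L v w"
    and min: "\<And>v' w'. lattice_basis L v' w' \<Longrightarrow> superbase_energy v w \<le> superbase_energy v' w'"
    using minimal_superbase[OF assms] by blast
  \<comment> \<open>If two vectors of the superbase formed an acute angle, negating one of them would give a
    superbase of smaller energy.\<close>
  have energy: "superbase_energy v (- w) = superbase_energy v w - 4 * (v \<bullet> w)"
    "superbase_energy (- v - w) (- v) = superbase_energy v w - 4 * ((- v - w) \<bullet> v)"
    "superbase_energy (- w - v) (- w) = superbase_energy v w - 4 * ((- v - w) \<bullet> w)"
    by (simp_all add: superbase_energy_def inner_plane algebra_simps)
  have "superbase_energy v w \<le> superbase_energy v (- w)"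
    using min[OF lattice_basis_uminus_right[OF basis]] .
  moreover have "superbase_energy v w \<le> superbase_energy (- v - w) (- v)"
    using min[OF lattice_basis_uminus_right[OF lattice_basis_third[OF basis]]] .
  moreover have "superbase_energy v w \<le> superbase_energy (- w - v) (- w)"
    using min[OF lattice_basis_uminus_right[OF lattice_basis_third[OF lattice_basis_swap[OF basis]]]] .
  ultimately have "obtuse_superbase L (- v - w) v w"
    using basis unfolding obtuse_superbase_def energy by simp
  then show thesis ..
qed

text \<open>Substituting \<open>v0 = - v1 - v2\<close> turns the products with \<open>v0\<close>
  into squared lengths; \<open>0 \<le> p\<close> and the order make all three products
  nonnegative.\<close>

lemma sorted_superbase_iff:
  "sorted_superbase L v1 v2 p q r \<longleftrightarrow>
     (\<exists>v0. obtuse_superbase L v0 v1 v2 \<and> - (v1 \<bullet> v2) = p \<and> - (v0 \<bullet> v1) = q \<and> - (v0 \<bullet> v2) = r \<and>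
       p \<le> q \<and> q \<le> r)"
  by (auto simp: sorted_superbase_def obtuse_superbase_def inner_diff_left inner_diff_right inner_commute)

lemma sorted_superbase_exists:
  assumes "is_lattice L"
  obtains v w p q r where "sorted_superbase L v w p q r"
proof -
  obtain v0 v1 v2 where obt: "obtuse_superbase L v0 v1 v2"
    using obtuse_superbase_exists[OF assms] .
  \<comment> \<open>Swap and rotation generate all six labellings. One of them sorts the products;
    the inner products are their negatives, so the inequalities in \<open>key\<close> run the other
    way.\<close>
  have perm: "obtuse_superbase L v0 v2 v1" "obtuse_superbase L v2 v0 v1" "obtuse_superbase L v2 v1 v0"
    "obtuse_superbase L v1 v2 v0" "obtuse_superbase L v1 v0 v2"
    using obt obtuse_superbase_rotate obtuse_superbase_swap by blast+
  have key: thesis if "obtuse_superbase L u0 u1 u2" "u0 \<bullet> u2 \<le> u0 \<bullet> u1" "u0 \<bullet> u1 \<le> u1 \<bullet> u2" for u0 u1 u2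
    using that by (intro \<open>\<And>v w p q r. sorted_superbase L v w p q r \<Longrightarrow> thesis\<close>) (auto simp: sorted_superbase_iff)
  consider "v0 \<bullet> v2 \<le> v0 \<bullet> v1 \<and> v0 \<bullet> v1 \<le> v1 \<bullet> v2" | "v0 \<bullet> v1 \<le> v0 \<bullet> v2 \<and> v0 \<bullet> v2 \<le> v1 \<bullet> v2"
    | "v1 \<bullet> v2 \<le> v0 \<bullet> v2 \<and> v0 \<bullet> v2 \<le> v0 \<bullet> v1" | "v0 \<bullet> v2 \<le> v1 \<bullet> v2 \<and> v1 \<bullet> v2 \<le> v0 \<bullet> v1"
    | "v0 \<bullet> v1 \<le> v1 \<bullet> v2 \<and> v1 \<bullet> v2 \<le> v0 \<bullet> v2" | "v1 \<bullet> v2 \<le> v0 \<bullet> v1 \<and> v0 \<bullet> v1 \<le> v0 \<bullet> v2"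
    by linarith
  then show thesis
    using key[OF obt] perm[THEN key] by cases (auto simp: inner_commute)
qed

text \<open>The three conditions match one by one: \<open>v \<bullet> w \<le> 0\<close> is
  \<open>0 \<le> p\<close>, the lower bound on \<open>v \<bullet> w\<close> is
  \<open>p \<le> q\<close>, and the order of the norms is \<open>q \<le> r\<close>.\<close>

lemma reduced_basis_iff: "reduced_basis L v w \<longleftrightarrow> (\<exists>p q r. sorted_superbase L v w p q r)"
proof
  assume "reduced_basis L v w"
  then have "sorted_superbase L v w (- (v \<bullet> w)) (v \<bullet> v + v \<bullet> w) (w \<bullet> w + v \<bullet> w)"
    by (auto simp: reduced_basis_def sorted_superbase_def norm_eq_sqrt_inner)
  then show "\<exists>p q r. sorted_superbase L v w p q r"
    by blast
qed (auto simp: reduced_basis_def sorted_superbase_def norm_eq_sqrt_inner)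

section \<open>Selling's formula and the successive minima\<close>

text \<open>All three terms are nonnegative, so for integer coefficients a lower bound on the length
  depends only on which of \<open>a\<close>, \<open>b\<close>, \<open>a - b\<close> vanish.\<close>

lemma selling_formula:
  assumes "sorted_superbase L v w p q r"
  shows "(a *\<^sub>R v + b *\<^sub>R w) \<bullet> (a *\<^sub>R v + b *\<^sub>R w) = p * (a - b)\<^sup>2 + q * a\<^sup>2 + r * b\<^sup>2"
proof -
  have "(a *\<^sub>R v + b *\<^sub>R w) \<bullet> (a *\<^sub>R v + b *\<^sub>R w) = a\<^sup>2 * (v \<bullet> v) + 2 * a * b * (v \<bullet> w) + b\<^sup>2 * (w \<bullet> w)"
    by (simp add: inner_plane algebra_simps power2_eq_square)
  then show ?thesis
    using assms inner_commute[of v w] by (simp add: sorted_superbase_def algebra_simps power2_eq_square)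
qed

lemma of_int_square_ge_1: "a \<noteq> 0 \<Longrightarrow> 1 \<le> (of_int a :: real)\<^sup>2"
  by (metis of_int_1_le_iff of_int_power zero_less_power2 int_one_le_iff_zero_less)

text \<open>At most one of \<open>a\<close>, \<open>b\<close>, \<open>a - b\<close> vanishes, so at
  least two of the three products are counted in full, and the two smallest are \<open>p\<close> and
  \<open>q\<close>.\<close>

lemma sorted_superbase_first_minimum:
  assumes S: "sorted_superbase L v w p q r" and z: "z \<in> L" "z \<noteq> 0"
  shows "p + q \<le> z \<bullet> z"
proof -
  obtain a b :: int where ab: "z = of_int a *\<^sub>R v + of_int b *\<^sub>R w"
    using S z lattice_basis_mem by (auto simp: sorted_superbase_def)
  note le = S[unfolded sorted_superbase_def]
  define A B C where "A = (of_int a :: real)\<^sup>2" "B = (of_int b :: real)\<^sup>2" "C = (of_int (a - b) :: real)\<^sup>2"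
  have eq: "z \<bullet> z = p * C + q * A + r * B"
    unfolding ab selling_formula[OF S] A_B_C_def by simp
  have nn: "A \<ge> 0" "B \<ge> 0" "C \<ge> 0"
    by (simp_all add: A_B_C_def)
  have m: "t \<le> t * X" if "X \<ge> 1" "t \<ge> 0" for t X :: real
    using that mult_left_mono[of 1 X t] by simp
  have "(A \<ge> 1 \<and> B \<ge> 1) \<or> (A \<ge> 1 \<and> C \<ge> 1) \<or> (B \<ge> 1 \<and> C \<ge> 1)"
    using z(2) of_int_square_ge_1[of a] of_int_square_ge_1[of b] of_int_square_ge_1[of "a - b"]
    unfolding A_B_C_def ab by fastforce
  then show ?thesis
    unfolding eq using le nn m[of A q] m[of B r] m[of C p]
      mult_nonneg_nonneg[of p C] mult_nonneg_nonneg[of q A] mult_nonneg_nonneg[of r B] by linarith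
qed

text \<open>Here \<open>b\<close> contributes \<open>r\<close>, and \<open>a\<close> and
  \<open>a - b\<close> cannot both vanish, which contributes at least \<open>p\<close>.\<close>

lemma sorted_superbase_second_minimum:
  assumes S: "sorted_superbase L v w p q r" and b: "b \<noteq> 0"
  shows "p + r \<le> (of_int a *\<^sub>R v + of_int b *\<^sub>R w) \<bullet> (of_int a *\<^sub>R v + of_int b *\<^sub>R w)"
proof -
  note le = S[unfolded sorted_superbase_def]
  define A B C where "A = (of_int a :: real)\<^sup>2" "B = (of_int b :: real)\<^sup>2" "C = (of_int (a - b) :: real)\<^sup>2"
  have nn: "A \<ge> 0" "B \<ge> 0" "C \<ge> 0"
    by (simp_all add: A_B_C_def)
  have m: "t \<le> t * X" if "X \<ge> 1" "t \<ge> 0" for t X :: real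
    using that mult_left_mono[of 1 X t] by simp
  have "B \<ge> 1 \<and> (A \<ge> 1 \<or> C \<ge> 1)"
    using b of_int_square_ge_1[of a] of_int_square_ge_1[of b] of_int_square_ge_1[of "a - b"]
    unfolding A_B_C_def by fastforce
  then have "p + r \<le> p * C + q * A + r * B"
    using le nn m[of A q] m[of B r] m[of C p]
      mult_nonneg_nonneg[of p C] mult_nonneg_nonneg[of q A] mult_nonneg_nonneg[of r B] by linarith
  then show ?thesis
    unfolding selling_formula[OF S] A_B_C_def by simp
qed

text \<open>For the second bound, \<open>v'\<close> and \<open>w'\<close> are not both multiples of
  \<open>v\<close>, so one of them has a nonzero \<open>w\<close>-coordinate; neither has squared
  length above \<open>p' + r'\<close>.\<close>

lemma sorted_superbase_minima_le:
  assumes S: "sorted_superbase L v w p q r" and T: "sorted_superbase L v' w' p' q' r'"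
  shows "p + q \<le> p' + q'" "p + r \<le> p' + r'"
proof -
  have basis: "lattice_basis L v w" and basis': "lattice_basis L v' w'"
    using S T by (auto simp: sorted_superbase_def)
  have "v' \<noteq> 0"
    using lattice_basis_cross2[OF basis'] by (auto simp: cross2_def)
  then show "p + q \<le> p' + q'"
    using sorted_superbase_first_minimum[OF S lattice_basis_in(1)[OF basis']] T
    by (simp add: sorted_superbase_def)
  obtain a b c d :: int where vw: "v' = of_int a *\<^sub>R v + of_int b *\<^sub>R w" "w' = of_int c *\<^sub>R v + of_int d *\<^sub>R w"
    using lattice_basis_mem[OF basis] lattice_basis_in[OF basis'] by auto
  have "b \<noteq> 0 \<or> d \<noteq> 0"
    using lattice_basis_cross2[OF basis'] by (auto simp: vw cross2_def)
  then have "p + r \<le> v' \<bullet> v' \<or> p + r \<le> w' \<bullet> w'"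
    unfolding vw using sorted_superbase_second_minimum[OF S] by blast
  then show "p + r \<le> p' + r'"
    using T by (auto simp: sorted_superbase_def)
qed

text \<open>The two minima and the covolume determine \<open>p\<close>, because
  \<open>p\<^sup>2 = (p + q) (p + r) - covolume\<^sup>2\<close>.\<close>

lemma sorted_superbase_unique:
  assumes S: "sorted_superbase L v w p q r" and T: "sorted_superbase L v' w' p' q' r'"
  shows "p' = p \<and> q' = q \<and> r' = r"
proof -
  have minima: "p + q = p' + q'" "p + r = p' + r'"
    using sorted_superbase_minima_le[OF S T] sorted_superbase_minima_le[OF T S] by auto
  have "(cross2 v w)\<^sup>2 = (cross2 v' w')\<^sup>2"
    using S T by (intro lattice_basis_cross2_square) (auto simp: sorted_superbase_def)
  then have "(p + q) * (p + r) - p\<^sup>2 = (p' + q') * (p' + r') - p'\<^sup>2"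
    using S T by (simp add: cross2_square sorted_superbase_def)
  then have "p\<^sup>2 = p'\<^sup>2"
    using minima by simp
  then have "p = p'"
    using S T by (auto simp: sorted_superbase_def)
  then show ?thesis
    using minima by simp
qed

section \<open>The root invariant and uniqueness of the superbase\<close>

lemma root_invariant_eq:
  assumes S: "sorted_superbase L v w p q r"
  shows "root_invariant L = (sqrt p, sqrt q, sqrt r)"
  unfolding root_invariant_def
proof (rule the_equality)
  show "\<exists>v0 v1 v2. obtuse_superbase L v0 v1 v2 \<and>
        (sqrt p, sqrt q, sqrt r) = (root_product v1 v2, root_product v0 v1, root_product v0 v2) \<and>
        root_product v1 v2 \<le> root_product v0 v1 \<and> root_product v0 v1 \<le> root_product v0 v2"
  proof -
    obtain v0 where "obtuse_superbase L v0 v w" "p = - (v \<bullet> w)" "q = - (v0 \<bullet> v)" "r = - (v0 \<bullet> w)" "p \<le> q" "q \<le> r"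
      using S unfolding sorted_superbase_iff by blast
    then show ?thesis
      unfolding root_product_def by (intro exI[of _ v0] exI[of _ v] exI[of _ w]) simp
  qed
next
  fix t
  assume "\<exists>v0 v1 v2. obtuse_superbase L v0 v1 v2 \<and>
        t = (root_product v1 v2, root_product v0 v1, root_product v0 v2) \<and>
        root_product v1 v2 \<le> root_product v0 v1 \<and> root_product v0 v1 \<le> root_product v0 v2"
  then obtain v0 v1 v2 where obt: "obtuse_superbase L v0 v1 v2"
    and t: "t = (root_product v1 v2, root_product v0 v1, root_product v0 v2)"
    and le: "root_product v1 v2 \<le> root_product v0 v1" "root_product v0 v1 \<le> root_product v0 v2"
    by blast
  have "sorted_superbase L v1 v2 (- (v1 \<bullet> v2)) (- (v0 \<bullet> v1)) (- (v0 \<bullet> v2))"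
    using obt le unfolding sorted_superbase_iff root_product_def by auto
  from sorted_superbase_unique[OF S this] show "t = (sqrt p, sqrt q, sqrt r)"
    by (simp add: t root_product_def)
qed

text \<open>The products are nonnegative, so squaring undoes the roots: the root invariant gives
  back the Gram matrix of a basis.\<close>

lemma root_invariant_sorted_superbase:
  assumes "is_lattice L" "root_invariant L = (a, b, c)"
  obtains v w where "sorted_superbase L v w (a\<^sup>2) (b\<^sup>2) (c\<^sup>2)"
proof -
  obtain v w p q r where S: "sorted_superbase L v w p q r"
    using sorted_superbase_exists[OF assms(1)] .
  then have "p = a\<^sup>2" "q = b\<^sup>2" "r = c\<^sup>2"
    using root_invariant_eq[OF S] assms(2) by (auto simp: sorted_superbase_def)
  then show thesis
    using S that by blast
qed

text \<open>Each strict inequality removes one ambiguity. From \<open>q < r\<close>, the vector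
  \<open>v'\<close> is too short to have a \<open>w\<close>-coordinate; from \<open>p < q\<close>, a
  \<open>v\<close>-coordinate would make \<open>w'\<close> too long; from \<open>0 < p\<close>, the
  inner product \<open>- p\<close> forces the two remaining signs to agree.\<close>

lemma sorted_superbase_strict_unique:
  assumes S: "sorted_superbase L v w p q r" and T: "sorted_superbase L v' w' p q r"
    and strict: "0 < p" "p < q" "q < r"
  shows "v' = v \<and> w' = w \<or> v' = - v \<and> w' = - w"
proof -
  have basis: "lattice_basis L v w" and basis': "lattice_basis L v' w'"
    using S T by (auto simp: sorted_superbase_def)
  note inner = S[unfolded sorted_superbase_def] T[unfolded sorted_superbase_def]
  obtain a b c d :: int where vw: "v' = of_int a *\<^sub>R v + of_int b *\<^sub>R w" "w' = of_int c *\<^sub>R v + of_int d *\<^sub>R w"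
    using lattice_basis_mem[OF basis] lattice_basis_in[OF basis'] by auto
  have "b = 0"
    using sorted_superbase_second_minimum[OF S, of b a] inner strict unfolding vw by force
  then have "(of_int a :: real)\<^sup>2 * (p + q) = p + q"
    using inner by (simp add: vw power2_eq_square mult.assoc)
  then have a: "a = 1 \<or> a = - 1"
    using strict by (auto simp: power2_eq_1_iff)
  have d0: "d \<noteq> 0"
    using lattice_basis_cross2[OF basis'] \<open>b = 0\<close> by (auto simp: vw cross2_def)
  have "c = 0"
  proof (rule ccontr)
    assume c0: "c \<noteq> 0"
    define A B C where "A = (of_int c :: real)\<^sup>2" "B = (of_int d :: real)\<^sup>2" "C = (of_int (c - d) :: real)\<^sup>2"
    have "p * C + q * A + r * B = p + r"
      using selling_formula[OF S, of "of_int c" "of_int d"] inner by (simp add: vw A_B_C_def)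
    moreover have "A \<ge> 1" "B \<ge> 1" "C \<ge> 0"
      using c0 d0 by (simp_all add: A_B_C_def of_int_square_ge_1)
    ultimately show False
      using strict mult_left_mono[of 1 A q] mult_left_mono[of 1 B r] mult_nonneg_nonneg[of p C] by linarith
  qed
  then have "(of_int d :: real)\<^sup>2 * (p + r) = p + r"
    using inner by (simp add: vw power2_eq_square mult.assoc)
  then have d: "d = 1 \<or> d = - 1"
    using strict by (auto simp: power2_eq_1_iff)
  have "of_int a * of_int d * p = p"
    using inner \<open>b = 0\<close> \<open>c = 0\<close> by (simp add: vw mult.commute)
  then show ?thesis
    using a d strict \<open>b = 0\<close> \<open>c = 0\<close> by (auto simp: vw)
qed

subsection \<open>Isometries and the sign\<close>

text \<open>The isometry transfers coordinates from the basis \<open>v\<close>, \<open>w\<close> to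
  \<open>v'\<close>, \<open>w'\<close>. By bilinearity, inner products depend only on coordinates
  and Gram entries.\<close>

lemma gram_isometry:
  assumes nz: "cross2 v w \<noteq> 0"
    and gram: "v' \<bullet> v' = v \<bullet> v" "w' \<bullet> w' = w \<bullet> w" "v' \<bullet> w' = v \<bullet> w"
  obtains f where "orthogonal_transformation f" "f v = v'" "f w = w'"
proof
  \<comment> \<open>The coordinates of \<open>z\<close> in the basis \<open>v\<close>,
    \<open>w\<close>, by Cramer's rule.\<close>
  define s t where "s z = cross2 z w / cross2 v w" "t z = cross2 v z / cross2 v w" for z
  define f where "f z = s z *\<^sub>R v' + t z *\<^sub>R w'" for z
  have add: "s (y + z) = s y + s z" "t (y + z) = t y + t z"
    and scale: "s (c *\<^sub>R z) = c * s z" "t (c *\<^sub>R z) = c * t z" for y z c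
    by (simp_all add: s_t_def cross2_def field_simps diff_divide_distrib add_divide_distrib)
  have "linear f"
    by (rule linearI) (simp_all add: f_def add scale algebra_simps)
  moreover have "f y \<bullet> f z = y \<bullet> z" for y z
  proof -
    have "f y \<bullet> f z = s y * s z * (v \<bullet> v) + (s y * t z + t y * s z) * (v \<bullet> w) + t y * t z * (w \<bullet> w)"
      using gram inner_commute[of v' w']
      by (simp add: f_def inner_add_left inner_add_right algebra_simps)
    also have "\<dots> = (s y *\<^sub>R v + t y *\<^sub>R w) \<bullet> (s z *\<^sub>R v + t z *\<^sub>R w)"
      using inner_commute[of v w]
      by (simp add: inner_add_left inner_add_right algebra_simps)
    also have "\<dots> = y \<bullet> z"
      using cross2_decompose[OF nz, of y] cross2_decompose[OF nz, of z] by (simp add: s_t_def)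
    finally show ?thesis .
  qed
  ultimately show "orthogonal_transformation f"
    by (simp add: orthogonal_transformation_def)
  have "cross2 v v = 0" "cross2 w w = 0"
    by (simp_all add: cross2_def)
  then show "f v = v'" "f w = w'"
    using nz by (simp_all add: f_def s_t_def)
qed

lemma lattice_basis_image:
  assumes "linear f" and basis: "lattice_basis L v w" and basis': "lattice_basis L' (f v) (f w)"
  shows "f ` L = L'"
proof -
  have "f (of_int a *\<^sub>R v + of_int b *\<^sub>R w) = of_int a *\<^sub>R f v + of_int b *\<^sub>R f w" for a b :: int
    using \<open>linear f\<close> by (simp add: linear_add linear_scale)
  then have "f z \<in> L'" if "z \<in> L" for z
    using that lattice_basis_mem[OF basis] lattice_basis_mem[OF basis'] by metis
  moreover have "z \<in> f ` L" if z: "z \<in> L'" for z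
  proof -
    obtain a b :: int where "z = of_int a *\<^sub>R f v + of_int b *\<^sub>R f w"
      using z lattice_basis_mem[OF basis'] by blast
    then have "z = f (of_int a *\<^sub>R v + of_int b *\<^sub>R w)"
      using \<open>linear f\<close> by (simp add: linear_add linear_scale)
    then show ?thesis
      using lattice_basis_mem[OF basis] by blast
  qed
  ultimately show ?thesis
    by blast
qed

lemma sorted_superbase_isometry:
  assumes S: "sorted_superbase L v w p q r" and T: "sorted_superbase L' v' w' p q r"
  obtains f where "orthogonal_transformation f" "f v = v'" "f w = w'" "f ` L = L'"
proof -
  have nz: "cross2 v w \<noteq> 0"
    using S lattice_basis_cross2 by (auto simp: sorted_superbase_def)
  obtain f where f: "orthogonal_transformation f" "f v = v'" "f w = w'"
    using S T by (rule_tac gram_isometry[OF nz, of v' w']) (auto simp: sorted_superbase_def)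
  moreover have "f ` L = L'"
    using S T f by (intro lattice_basis_image[of f L v w])
      (auto simp: sorted_superbase_def orthogonal_transformation_def)
  ultimately show thesis ..
qed

lemma sorted_superbase_isometric:
  assumes S: "sorted_superbase L v w p q r" and T: "sorted_superbase L' v' w' p q r"
  shows "isometric L L'"
proof -
  obtain f where "orthogonal_transformation f" "f ` L = L'"
    using sorted_superbase_isometry[OF S T] by blast
  then show ?thesis
    using orthogonal_transformation_isometry by (auto simp: isometric_def)
qed

lemma cross2_matrix: "cross2 (A *v v) (A *v w) = det A * cross2 v w"
  by (simp add: cross2_def matrix_vector_mult_def sum_2 det_2 algebra_simps)

text \<open>The isometry between the superbases multiplies areas by its determinant. Equal Gram
  matrices give equal absolute areas, so equal signs make the determinant 1.\<close>

lemma sorted_superbase_rigidly_equivalent: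
  assumes S: "sorted_superbase L v w p q r" and T: "sorted_superbase L' v' w' p q r"
    and sgn: "sgn (cross2 v w) = sgn (cross2 v' w')"
  shows "rigidly_equivalent L L'"
proof -
  obtain f where f: "orthogonal_transformation f" "f v = v'" "f w = w'" "f ` L = L'"
    using sorted_superbase_isometry[OF S T] .
  then have A: "matrix f *v z = f z" for z
    by (simp add: orthogonal_transformation_def matrix_works)
  have "(cross2 v w)\<^sup>2 = (cross2 v' w')\<^sup>2"
    using S T by (simp add: cross2_square sorted_superbase_def)
  then have "\<bar>cross2 v w\<bar> = \<bar>cross2 v' w'\<bar>"
    by (simp add: power2_eq_iff abs_eq_iff)
  then have "cross2 v w = cross2 v' w'"
    using sgn by (metis abs_sgn mult_sgn_abs)
  moreover have "cross2 v w \<noteq> 0"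
    using S lattice_basis_cross2 by (auto simp: sorted_superbase_def)
  ultimately have "det (matrix f) = 1"
    using cross2_matrix[of "matrix f" v w] by (simp add: A f)
  then have "rotation_matrix (matrix f)"
    using f(1) by (simp add: rotation_matrix_def orthogonal_transformation_matrix)
  then show ?thesis
    using f(4) A unfolding rigidly_equivalent_def
    by (intro exI[of _ "matrix f"] exI[of _ 0]) simp
qed

section \<open>Realization of prescribed products with either orientation\<close>

text \<open>Put \<open>v\<close> on the first axis with length \<open>A\<close>; then
  \<open>w\<close> is determined by its inner product \<open>- p\<close> with \<open>v\<close> and
  the oriented area \<open>s * D\<close>, where \<open>D\<close> squared is the Gram determinant
  \<open>(p + q) * (p + r) - p\<^sup>2\<close>. The bound \<open>0 < q\<close> keeps
  \<open>A\<close> and \<open>D\<close> positive.\<close>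

lemma sorted_superbase_realization:
  assumes "0 \<le> p" "p \<le> q" "q \<le> r" "0 < q" and s: "s = 1 \<or> s = (-1 :: real)"
  obtains L v w where "sorted_superbase L v w p q r" "sgn (cross2 v w) = s"
proof -
  define A D where "A = sqrt (p + q)" "D = sqrt (p * q + p * r + q * r)"
  define v w :: plane where "v = vector [A, 0]" "w = vector [- p / A, s * D / A]"
  have "0 < q * r" "0 \<le> p * q" "0 \<le> p * r"
    using assms by simp_all
  then have AD: "A > 0" "D > 0" "A\<^sup>2 = p + q" "D\<^sup>2 = p * q + p * r + q * r"
    using assms by (simp_all add: A_D_def add_nonneg_pos)
  have cross: "cross2 v w = s * D"
    using AD(1) by (simp add: cross2_def v_w_def)
  have "w \<bullet> w = (p\<^sup>2 + D\<^sup>2) / A\<^sup>2"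
    using s by (auto simp: inner_plane v_w_def power2_eq_square add_divide_distrib)
  also have "\<dots> = p + r"
    unfolding AD(3,4) using assms by (simp add: field_simps power2_eq_square)
  finally have "w \<bullet> w = p + r" .
  moreover have "v \<bullet> v = p + q" "v \<bullet> w = - p"
    using AD(1,3) by (simp_all add: inner_plane v_w_def power2_eq_square)
  moreover have "cross2 v w \<noteq> 0"
    using s AD(2) by (auto simp: cross)
  ultimately have "sorted_superbase {of_int a *\<^sub>R v + of_int b *\<^sub>R w | a b :: int. True} v w p q r"
    using assms by (simp add: sorted_superbase_def lattice_basis_iff)
  moreover have "sgn (cross2 v w) = s"
    using s AD(2) by (auto simp: cross)
  ultimately show thesis ..
qed

section \<open>Reflections and the sign\<close>

text \<open>The linear part \<open>R\<close> of a reflection preserving \<open>L\<close> also maps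
  \<open>L\<close> into itself, since it takes \<open>z\<close> to the difference of the images of
  \<open>z\<close> and 0. It would carry the superbase to one with the same products, that is, to
  itself up to a common sign; this keeps the orientation, which \<open>R\<close> reverses.\<close>

lemma sorted_superbase_no_reflection:
  assumes S: "sorted_superbase L v w p q r" and strict: "0 < p" "p < q" "q < r" and "u \<noteq> 0"
  shows "line_reflection c u ` L \<noteq> L"
proof
  assume image: "line_reflection c u ` L = L"
  have basis: "lattice_basis L v w"
    using S by (simp add: sorted_superbase_def)
  define R where "R = line_reflection 0 u"
  have uu: "u \<bullet> u \<noteq> 0"
    using \<open>u \<noteq> 0\<close> by simp
  have inner: "R y \<bullet> R z = y \<bullet> z" for y z
    using uu by (simp add: R_def line_reflection_def inner_diff_left inner_diff_right inner_commute field_simps)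
  have cross: "cross2 (R y) (R z) = - cross2 y z" for y z
  proof -
    have "cross2 (R y) (R z) =
        cross2 y z - (2 * (z \<bullet> u) / (u \<bullet> u)) * cross2 y u - (2 * (y \<bullet> u) / (u \<bullet> u)) * cross2 u z"
      by (simp add: R_def line_reflection_def cross2_def algebra_simps)
    also have "\<dots> = cross2 y z - 2 * ((z \<bullet> u) * cross2 y u + (y \<bullet> u) * cross2 u z) / (u \<bullet> u)"
      by (simp add: add_divide_distrib algebra_simps)
    \<comment> \<open>The area of \<open>y\<close> and \<open>z\<close> computed in the orthogonal
      frame of \<open>u\<close> and its quarter turn.\<close>
    also have "(z \<bullet> u) * cross2 y u + (y \<bullet> u) * cross2 u z = cross2 y z * (u \<bullet> u)"
      by (simp add: cross2_def inner_plane algebra_simps)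
    finally show ?thesis
      using uu by simp
  qed
  have "0 \<in> L"
    using lattice_basis_diff[OF basis lattice_basis_in(1)[OF basis] lattice_basis_in(1)[OF basis]] by simp
  have RL: "R z \<in> L" if "z \<in> L" for z
  proof -
    have "R z = line_reflection c u z - line_reflection c u 0"
      by (simp add: R_def line_reflection_def inner_diff_left algebra_simps diff_divide_distrib)
    then show ?thesis
      using lattice_basis_diff[OF basis] image \<open>0 \<in> L\<close> that by auto
  qed
  obtain k l m n :: int where
    Rv: "R v = of_int k *\<^sub>R v + of_int l *\<^sub>R w" and Rw: "R w = of_int m *\<^sub>R v + of_int n *\<^sub>R w"
    using RL[OF lattice_basis_in(1)[OF basis]] RL[OF lattice_basis_in(2)[OF basis]]
    unfolding lattice_basis_mem[OF basis] by blast
  \<comment> \<open>Reversal of orientation gives the integer matrix of \<open>R\<close> determinant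
    -1, so it carries bases to bases.\<close>
  have "of_int (k * n - l * m) * cross2 v w = of_int (-1) * cross2 v w"
    using cross[of v w] unfolding Rv Rw cross2_comb by simp
  then have "k * n - l * m = -1"
    unfolding mult_cancel_right of_int_eq_iff using lattice_basis_cross2[OF basis] by simp
  then have "lattice_basis L (R v) (R w)"
    unfolding Rv Rw by (intro lattice_basis_unimodular[OF basis]) simp
  then have "sorted_superbase L (R v) (R w) p q r"
    using S by (simp add: sorted_superbase_def inner)
  from sorted_superbase_strict_unique[OF S this strict] have "cross2 (R v) (R w) = cross2 v w"
    by (auto simp: cross2_def)
  then show False
    using cross[of v w] lattice_basis_cross2[OF basis] by simp
qed

lemma lattice_sign_eq:
  assumes S: "sorted_superbase L v w p q r" and strict: "0 < p" "p < q" "q < r"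
  shows "lattice_sign L = sgn (cross2 v w)"
proof -
  have "(THE s. \<exists>v0 v1 v2. obtuse_superbase L v0 v1 v2 \<and> norm v1 < norm v2 \<and> norm v2 < norm v0 \<and>
      s = sgn (det (vector [v1, v2] :: real ^ 2 ^ 2))) = sgn (cross2 v w)"
    unfolding det_vector_cross2
  proof (rule the_equality)
    have "norm v < norm w" "norm w < norm (- v - w)" "obtuse_superbase L (- v - w) v w"
      using S strict
      by (auto simp: sorted_superbase_def norm_eq_sqrt_inner inner_diff_left inner_diff_right
          inner_commute obtuse_superbase_def)
    then show "\<exists>v0 v1 v2. obtuse_superbase L v0 v1 v2 \<and> norm v1 < norm v2 \<and> norm v2 < norm v0 \<and>
        sgn (cross2 v w) = sgn (cross2 v1 v2)"
      by blast
  next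
    fix s
    assume "\<exists>v0 v1 v2. obtuse_superbase L v0 v1 v2 \<and> norm v1 < norm v2 \<and> norm v2 < norm v0 \<and>
        s = sgn (cross2 v1 v2)"
    then obtain v0 v1 v2 where obt: "obtuse_superbase L v0 v1 v2"
      and less: "norm v1 < norm v2" "norm v2 < norm v0" and s: "s = sgn (cross2 v1 v2)"
      by blast
    have "sorted_superbase L v1 v2 (- (v1 \<bullet> v2)) (v1 \<bullet> v1 + v1 \<bullet> v2) (v2 \<bullet> v2 + v1 \<bullet> v2)"
      using obt less
      by (auto simp: sorted_superbase_def obtuse_superbase_def norm_eq_sqrt_inner
          inner_diff_left inner_diff_right inner_commute)
    moreover from this have "- (v1 \<bullet> v2) = p" "v1 \<bullet> v1 + v1 \<bullet> v2 = q" "v2 \<bullet> v2 + v1 \<bullet> v2 = r"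
      using sorted_superbase_unique[OF S] by blast+
    ultimately have "sorted_superbase L v1 v2 p q r"
      by simp
    from sorted_superbase_strict_unique[OF S this strict] show "s = sgn (cross2 v w)"
      by (auto simp: s cross2_def)
  qed
  moreover have no_reflection: "\<not> (\<exists>c u. u \<noteq> 0 \<and> line_reflection c u ` L = L)"
    using sorted_superbase_no_reflection[OF S strict] by blast
  ultimately show ?thesis
    unfolding lattice_sign_def if_not_P[OF no_reflection] by simp
qed

subsection \<open>The anticlockwise angle\<close>

text \<open>The complex quotient has real part \<open>v \<bullet> w\<close> and imaginary part
  \<open>cross2 v w\<close>, up to a common positive factor. The cosine leaves two candidates, and
  the sign of the sine chooses between them.\<close>

lemma anticlockwise_angle_eq:
  assumes "cross2 v w \<noteq> 0"
  shows "anticlockwise_angle v w =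
    (if cross2 v w > 0 then arccos (v \<bullet> w / (norm v * norm w))
     else 2 * pi - arccos (v \<bullet> w / (norm v * norm w)))"
proof -
  have pos: "norm v > 0" "norm w > 0"
    using assms by (auto simp: cross2_def)
  define c d where "c = v \<bullet> w / (norm v * norm w)" "d = cross2 v w / (norm v * norm w)"
  have "c\<^sup>2 + d\<^sup>2 = ((v \<bullet> w)\<^sup>2 + (cross2 v w)\<^sup>2) / (norm v * norm w)\<^sup>2"
    by (simp add: c_d_def power_divide add_divide_distrib)
  also have "\<dots> = 1"
    using pos by (simp add: cross2_square power_mult_distrib dot_square_norm)
  finally have cd: "c\<^sup>2 + d\<^sup>2 = 1" .
  have "d \<noteq> 0"
    using assms pos by (simp add: c_d_def)
  then have "0 < d\<^sup>2"
    by simp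
  then have "c\<^sup>2 < 1"
    using cd by linarith
  \<comment> \<open>Strictness gives \<open>arccos c > 0\<close>, which keeps
    \<open>2 * pi - arccos c\<close> below \<open>2 * pi\<close>, in the range of
    \<open>Arg2pi\<close>.\<close>
  then have c: "-1 < c" "c < 1"
    using abs_square_less_1[of c] by auto
  define a where "a = (if cross2 v w > 0 then arccos c else 2 * pi - arccos c)"
  have "1 - c\<^sup>2 = d\<^sup>2"
    using cd by simp
  then have "sin (arccos c) = \<bar>d\<bar>"
    using c by (simp add: sin_arccos)
  moreover have "(0 < d) = (0 < cross2 v w)"
    using mult_pos_pos[OF pos] by (simp add: c_d_def pos_less_divide_eq)
  ultimately have a: "cos a = c" "sin a = d"
    using c \<open>d \<noteq> 0\<close> by (auto simp: a_def cos_diff sin_diff)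
  have range: "0 \<le> a" "a < 2 * pi"
    using c arccos_lt_bounded[of c] by (auto simp: a_def)
  define z where "z = Complex (w $ 1) (w $ 2) / Complex (v $ 1) (v $ 2)"
  have vv: "(v $ 1)\<^sup>2 + (v $ 2)\<^sup>2 = (norm v)\<^sup>2"
    unfolding dot_square_norm[symmetric] by (simp add: inner_plane power2_eq_square)
  have "Re z = (v \<bullet> w) / (norm v)\<^sup>2" "Im z = cross2 v w / (norm v)\<^sup>2"
    by (simp_all add: z_def Re_divide Im_divide vv inner_plane cross2_def mult.commute)
  then have polar: "of_real (norm w / norm v) * exp (\<i> * of_real a) = z"
    using pos by (simp add: cis_conv_exp[symmetric] complex_eq_iff a c_d_def power2_eq_square)
  then have "Arg2pi z = a"
    using pos range by (intro Arg2pi_unique[OF polar]) auto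
  then show ?thesis
    by (simp add: anticlockwise_angle_def z_def a_def c_d_def)
qed

subsection \<open>The quotient triangle\<close>

text \<open>A small shift towards each of the three edges stays in the triangle, so the three edge
  inequalities are strict.\<close>

lemma interior_quotient_triangle:
  assumes "(x, y) \<in> interior quotient_triangle"
  shows "0 < x \<and> 0 < y \<and> x + y < 1"
proof -
  obtain e where e: "e > 0" "ball (x, y) e \<subseteq> quotient_triangle"
    using assms by (auto simp: mem_interior)
  have "(x - e / 2, y) \<in> ball (x, y) e" "(x, y - e / 2) \<in> ball (x, y) e" "(x + e / 2, y) \<in> ball (x, y) e"
    using e(1) by (simp_all add: dist_Pair_Pair dist_real_def)
  then have "(x - e / 2, y) \<in> quotient_triangle" "(x, y - e / 2) \<in> quotient_triangle"
    "(x + e / 2, y) \<in> quotient_triangle"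
    using e(2) by blast+
  then show ?thesis
    using e(1) by (auto simp: quotient_triangle_def)
qed

text \<open>A linear system: the size gives the sum of the three root products, the projected
  invariant the smallest one and the difference of the other two.\<close>

lemma root_invariant_of_projected_invariant:
  assumes "\<sigma> > 0" "projected_invariant L = (x, y)" "lattice_size L = \<sigma>"
  shows "root_invariant L =
    (\<sigma> / 3 * y, \<sigma> / 6 * (3 - 3 * x - y), \<sigma> / 6 * (3 + 3 * x - y))"
proof -
  obtain a b c where abc: "root_invariant L = (a, b, c)"
    by (cases "root_invariant L")
  then have "a + b + c = \<sigma>" "c / \<sigma> - b / \<sigma> = x" "3 * (a / \<sigma>) = y"
    using assms by (auto simp: lattice_size_def projected_invariant_def)
  then have "a = \<sigma> / 3 * y" "c - b = \<sigma> * x" "b + c = \<sigma> - a"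
    using assms(1) by (auto simp: field_simps)
  then have "c = \<sigma> / 6 * (3 + 3 * x - y)" "b = \<sigma> / 6 * (3 - 3 * x - y)"
    by (simp_all add: field_simps)
  then show ?thesis
    using abc \<open>a = _\<close> by simp
qed

lemma projected_invariant_of_root_invariant:
  assumes "\<sigma> > 0"
    "root_invariant L = (\<sigma> / 3 * y, \<sigma> / 6 * (3 - 3 * x - y), \<sigma> / 6 * (3 + 3 * x - y))"
  shows "lattice_size L = \<sigma>" "projected_invariant L = (x, y)"
proof -
  show "lattice_size L = \<sigma>"
    by (simp add: lattice_size_def assms(2) algebra_simps)
  then show "projected_invariant L = (x, y)"
    using assms(1) by (simp add: projected_invariant_def assms(2) field_simps)
qed

text \<open>The scale \<open>\<sigma>\<close> cancels. Up to it, the squared lengths are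
  \<open>B - C\<close> and \<open>B + C\<close> with
  \<open>B = 9 * x\<^sup>2 + 5 * y\<^sup>2 - 6 * y + 9\<close> and
  \<open>C = 6 * x * (3 - y)\<close>, so the radicand is a difference of squares.\<close>

lemma angle_argument:
  fixes \<sigma> x y :: real
  assumes "\<sigma> > 0"
    and "r12 = \<sigma> / 3 * y" "r01 = \<sigma> / 6 * (3 - 3 * x - y)" "r02 = \<sigma> / 6 * (3 + 3 * x - y)"
  shows "- r12\<^sup>2 / (sqrt (r12\<^sup>2 + r01\<^sup>2) * sqrt (r12\<^sup>2 + r02\<^sup>2)) =
    - 4 * y\<^sup>2 / sqrt ((9 * x\<^sup>2 + 5 * y\<^sup>2 - 6 * y + 9)\<^sup>2 - 36 * x\<^sup>2 * (3 - y)\<^sup>2)"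
    (is "_ = _ / sqrt ?X")
proof -
  define t where "t = \<sigma>\<^sup>2 / 36"
  have t: "t > 0"
    using assms(1) by (simp add: t_def)
  have r: "r12\<^sup>2 = t * (4 * y\<^sup>2)" "r01\<^sup>2 = t * (3 - 3 * x - y)\<^sup>2" "r02\<^sup>2 = t * (3 + 3 * x - y)\<^sup>2"
    by (simp_all add: assms t_def power_mult_distrib power_divide)
  have "(r12\<^sup>2 + r01\<^sup>2) * (r12\<^sup>2 + r02\<^sup>2) = t\<^sup>2 * ?X"
    unfolding r by (simp add: algebra_simps power2_eq_square)
  then have "sqrt (r12\<^sup>2 + r01\<^sup>2) * sqrt (r12\<^sup>2 + r02\<^sup>2) = t * sqrt ?X"
    using t by (simp add: real_sqrt_mult[symmetric]) (simp add: real_sqrt_mult)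
  then show ?thesis
    using t by (simp add: r)
qed

section \<open>Classification of lattices by projected invariant, size and sign\<close>

text \<open>Reduced bases of \<open>Lp\<close> and \<open>Lm\<close> share one Gram matrix, so
  \<open>isometric_bases\<close> holds across the pair too. Only the orientation differs, and for
  \<open>Lm\<close> the anticlockwise angle is the rest of the full turn. Within one sign,
  uniqueness is up to rotation and translation.\<close>

theorem proposition4p9:
  fixes \<sigma> x y :: real
  assumes "\<sigma> > 0" and "(x, y) \<in> quotient_triangle"
  shows "let r12 = \<sigma> / 3 * y;
             r01 = \<sigma> / 6 * (3 - 3 * x - y);
             r02 = \<sigma> / 6 * (3 + 3 * x - y);
             \<theta> = arccos (- 4 * y\<^sup>2 /
                   sqrt ((9 * x\<^sup>2 + 5 * y\<^sup>2 - 6 * y + 9)\<^sup>2 - 36 * x\<^sup>2 * (3 - y)\<^sup>2))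
         in
         (\<exists>L. is_lattice L \<and> projected_invariant L = (x, y) \<and> lattice_size L = \<sigma>) \<and>
         (\<forall>L L'. is_lattice L \<and> projected_invariant L = (x, y) \<and> lattice_size L = \<sigma> \<and>
                 is_lattice L' \<and> projected_invariant L' = (x, y) \<and> lattice_size L' = \<sigma>
                 \<longrightarrow> isometric L L') \<and>
         (\<forall>L. is_lattice L \<and> projected_invariant L = (x, y) \<and> lattice_size L = \<sigma>
                 \<longrightarrow> root_invariant L = (r12, r01, r02)) \<and>
         ((x, y) \<in> interior quotient_triangle \<longrightarrow>
           (\<exists>Lp Lm.
              is_lattice Lp \<and> root_invariant Lp = (r12, r01, r02) \<and> lattice_sign Lp = 1 \<and>
              is_lattice Lm \<and> root_invariant Lm = (r12, r01, r02) \<and> lattice_sign Lm = -1 \<and>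
              (\<forall>L. is_lattice L \<and> root_invariant L = (r12, r01, r02) \<longrightarrow>
                 lattice_sign L = 1 \<and> rigidly_equivalent Lp L \<or>
                 lattice_sign L = -1 \<and> rigidly_equivalent Lm L) \<and>
              (\<forall>L \<in> {Lp, Lm}. \<exists>v1 v2. reduced_basis L v1 v2) \<and>
              (\<forall>L \<in> {Lp, Lm}. \<forall>L' \<in> {Lp, Lm}. \<forall>v1 v2 w1 w2.
                 reduced_basis L v1 v2 \<and> reduced_basis L' w1 w2 \<longrightarrow>
                 isometric_bases v1 v2 w1 w2) \<and>
              (\<forall>L \<in> {Lp, Lm}. \<forall>v1 v2. reduced_basis L v1 v2 \<longrightarrow>
                 norm v1 = sqrt (r12\<^sup>2 + r01\<^sup>2) \<and> norm v2 = sqrt (r12\<^sup>2 + r02\<^sup>2)) \<and>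
              (\<forall>v1 v2. reduced_basis Lp v1 v2 \<longrightarrow> anticlockwise_angle v1 v2 = \<theta>) \<and>
              (\<forall>v1 v2. reduced_basis Lm v1 v2 \<longrightarrow> anticlockwise_angle v1 v2 = 2 * pi - \<theta>)))"
proof -
  define r12 r01 r02 where r_def: "r12 = \<sigma> / 3 * y" "r01 = \<sigma> / 6 * (3 - 3 * x - y)" "r02 = \<sigma> / 6 * (3 + 3 * x - y)"
  define \<theta> where "\<theta> = arccos (- 4 * y\<^sup>2 /
      sqrt ((9 * x\<^sup>2 + 5 * y\<^sup>2 - 6 * y + 9)\<^sup>2 - 36 * x\<^sup>2 * (3 - y)\<^sup>2))"
  let ?S = "\<lambda>L v w. sorted_superbase L v w (r12\<^sup>2) (r01\<^sup>2) (r02\<^sup>2)"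
  have xy: "0 \<le> x" "x < 1" "0 \<le> y" "x + y \<le> 1"
    using assms(2) by (auto simp: quotient_triangle_def)
  \<comment> \<open>The edges \<open>x + y = 1\<close>, \<open>x = 0\<close> and
    \<open>y = 0\<close> correspond to \<open>r12 = r01\<close>, \<open>r01 = r02\<close> and
    \<open>r12 = 0\<close>.\<close>
  have diffs: "r01 - r12 = \<sigma> / 2 * (1 - x - y)" "r02 - r01 = \<sigma> * x"
    by (simp_all add: r_def field_simps)
  have "0 \<le> r01 - r12" "0 \<le> r02 - r01" "0 \<le> r12"
    unfolding diffs using assms(1) xy by (simp_all add: r_def)
  then have r_le: "0 \<le> r12" "r12 \<le> r01" "r01 \<le> r02"
    by simp_all
  \<comment> \<open>Here \<open>x < 1\<close> enters: \<open>x + y \<le> 1\<close> gives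
    \<open>3 - 3 * x - y \<ge> 2 * (1 - x)\<close>.\<close>
  have "0 < r01"
    unfolding r_def using assms(1) xy by simp
  have squares: "0 \<le> r12\<^sup>2" "r12\<^sup>2 \<le> r01\<^sup>2" "r01\<^sup>2 \<le> r02\<^sup>2" "0 < r01\<^sup>2"
    using r_le \<open>0 < r01\<close> by (auto intro: power_mono)
  have RI: "is_lattice L \<and> root_invariant L = (r12, r01, r02)" if "?S L v w" for L v w
    using root_invariant_eq[OF that] that r_le by (auto simp: sorted_superbase_def is_lattice_def)
  have PI: "is_lattice L \<and> projected_invariant L = (x, y) \<and> lattice_size L = \<sigma> \<longleftrightarrow>
      is_lattice L \<and> root_invariant L = (r12, r01, r02)" for L
    using root_invariant_of_projected_invariant[OF assms(1)]
      projected_invariant_of_root_invariant[OF assms(1)] unfolding r_def by blast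
  \<comment> \<open>Both orientations are realized at every point of the triangle; strict
    inequalities in the interior then turn the orientation into the sign of the lattice.\<close>
  obtain Lp vp wp where Sp: "?S Lp vp wp" and sgnp: "sgn (cross2 vp wp) = 1"
    using sorted_superbase_realization[OF squares, of 1] by blast
  obtain Lm vm wm where Sm: "?S Lm vm wm" and sgnm: "sgn (cross2 vm wm) = -1"
    using sorted_superbase_realization[OF squares, of "-1"] by blast
  have isom: "isometric L L'" if "is_lattice L \<and> root_invariant L = (r12, r01, r02)"
    "is_lattice L' \<and> root_invariant L' = (r12, r01, r02)" for L L'
    using that sorted_superbase_isometric root_invariant_sorted_superbase by metis
  have interior:
    "is_lattice Lp \<and> root_invariant Lp = (r12, r01, r02) \<and> lattice_sign Lp = 1 \<and>
      is_lattice Lm \<and> root_invariant Lm = (r12, r01, r02) \<and> lattice_sign Lm = -1 \<and>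
      (\<forall>L. is_lattice L \<and> root_invariant L = (r12, r01, r02) \<longrightarrow>
      lattice_sign L = 1 \<and> rigidly_equivalent Lp L \<or>
      lattice_sign L = -1 \<and> rigidly_equivalent Lm L) \<and>
      (\<forall>L \<in> {Lp, Lm}. \<exists>v1 v2. reduced_basis L v1 v2) \<and>
      (\<forall>L \<in> {Lp, Lm}. \<forall>L' \<in> {Lp, Lm}. \<forall>v1 v2 w1 w2.
      reduced_basis L v1 v2 \<and> reduced_basis L' w1 w2 \<longrightarrow>
      isometric_bases v1 v2 w1 w2) \<and>
      (\<forall>L \<in> {Lp, Lm}. \<forall>v1 v2. reduced_basis L v1 v2 \<longrightarrow>
      norm v1 = sqrt (r12\<^sup>2 + r01\<^sup>2) \<and> norm v2 = sqrt (r12\<^sup>2 + r02\<^sup>2)) \<and>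
      (\<forall>v1 v2. reduced_basis Lp v1 v2 \<longrightarrow> anticlockwise_angle v1 v2 = \<theta>) \<and>
      (\<forall>v1 v2. reduced_basis Lm v1 v2 \<longrightarrow> anticlockwise_angle v1 v2 = 2 * pi - \<theta>)"
    if "(x, y) \<in> interior quotient_triangle"
  proof (intro conjI)
    have "0 < x" "0 < y" "x + y < 1"
      using interior_quotient_triangle[OF that] by auto
    then have "0 < r01 - r12" "0 < r02 - r01" "0 < r12"
      unfolding diffs using assms(1) by (simp_all add: r_def)
    then have strict: "0 < r12\<^sup>2" "r12\<^sup>2 < r01\<^sup>2" "r01\<^sup>2 < r02\<^sup>2"
      by (auto intro: power_strict_mono)
    show "is_lattice Lp" "root_invariant Lp = (r12, r01, r02)"
      "is_lattice Lm" "root_invariant Lm = (r12, r01, r02)"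
      using RI Sp Sm by blast+
    show "lattice_sign Lp = 1" "lattice_sign Lm = -1"
      using lattice_sign_eq[OF Sp strict] lattice_sign_eq[OF Sm strict] sgnp sgnm by simp_all
    show "\<forall>L. is_lattice L \<and> root_invariant L = (r12, r01, r02) \<longrightarrow>
        lattice_sign L = 1 \<and> rigidly_equivalent Lp L \<or> lattice_sign L = -1 \<and> rigidly_equivalent Lm L"
    proof (intro allI impI)
      fix L assume "is_lattice L \<and> root_invariant L = (r12, r01, r02)"
      then obtain v w where S: "?S L v w"
        using root_invariant_sorted_superbase by blast
      then have "cross2 v w \<noteq> 0"
        using lattice_basis_cross2 by (auto simp: sorted_superbase_def)
      then have "sgn (cross2 v w) = 1 \<or> sgn (cross2 v w) = -1"
        by (simp add: sgn_real_def)
      then show "lattice_sign L = 1 \<and> rigidly_equivalent Lp L \<or> lattice_sign L = -1 \<and> rigidly_equivalent Lm L"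
        using sorted_superbase_rigidly_equivalent[OF Sp S] sorted_superbase_rigidly_equivalent[OF Sm S]
          lattice_sign_eq[OF S strict] sgnp sgnm by auto
    qed
    have "reduced_basis Lp vp wp" "reduced_basis Lm vm wm"
      using Sp Sm reduced_basis_iff by blast+
    then show "\<forall>L \<in> {Lp, Lm}. \<exists>v1 v2. reduced_basis L v1 v2"
      by blast
    have reduced: "?S L v w" if L: "L \<in> {Lp, Lm}" and red: "reduced_basis L v w" for L v w
    proof -
      obtain p q r where S: "sorted_superbase L v w p q r"
        using red by (auto simp: reduced_basis_iff)
      moreover have "p = r12\<^sup>2 \<and> q = r01\<^sup>2 \<and> r = r02\<^sup>2"
        using L Sp Sm sorted_superbase_unique[OF _ S] by blast
      ultimately show ?thesis
        by simp
    qed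
    show "\<forall>L \<in> {Lp, Lm}. \<forall>L' \<in> {Lp, Lm}. \<forall>v1 v2 w1 w2.
        reduced_basis L v1 v2 \<and> reduced_basis L' w1 w2 \<longrightarrow> isometric_bases v1 v2 w1 w2"
    proof (intro ballI allI impI)
      fix L L' v1 v2 w1 w2
      assume L: "L \<in> {Lp, Lm}" and L': "L' \<in> {Lp, Lm}"
        and red: "reduced_basis L v1 v2 \<and> reduced_basis L' w1 w2"
      obtain f where "orthogonal_transformation f" "f v1 = w1" "f v2 = w2"
        using sorted_superbase_isometry[OF reduced[OF L] reduced[OF L']] red by blast
      then show "isometric_bases v1 v2 w1 w2"
        unfolding isometric_bases_def by blast
    qed
    have norms: "norm v = sqrt (r12\<^sup>2 + r01\<^sup>2) \<and> norm w = sqrt (r12\<^sup>2 + r02\<^sup>2)" if "?S L v w" for L v w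
      using that by (simp add: sorted_superbase_def norm_eq_sqrt_inner)
    show "\<forall>L \<in> {Lp, Lm}. \<forall>v1 v2. reduced_basis L v1 v2 \<longrightarrow>
        norm v1 = sqrt (r12\<^sup>2 + r01\<^sup>2) \<and> norm v2 = sqrt (r12\<^sup>2 + r02\<^sup>2)"
      using norms[OF reduced] by simp
    have \<theta>: "arccos (v \<bullet> w / (norm v * norm w)) = \<theta>" if "?S L v w" for L v w
    proof -
      have "v \<bullet> w = - r12\<^sup>2"
        using that by (simp add: sorted_superbase_def)
      then show ?thesis
        unfolding \<theta>_def using angle_argument[OF assms(1) r_def] norms[OF that] by metis
    qed
    \<comment> \<open>A common sign change of both vectors preserves the area, so all reduced bases
      of one lattice have the orientation of the constructed one.\<close>
    have cross: "cross2 v w = cross2 v' w'" if "?S L v w" "?S L v' w'" for L v w v' w'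
      using sorted_superbase_strict_unique[OF that strict] by (auto simp: cross2_def)
    show "\<forall>v1 v2. reduced_basis Lp v1 v2 \<longrightarrow> anticlockwise_angle v1 v2 = \<theta>"
    proof (intro allI impI)
      fix v w assume "reduced_basis Lp v w"
      then have S: "?S Lp v w"
        using reduced by blast
      then have "cross2 v w > 0"
        using cross[OF Sp S] sgnp by (simp add: sgn_1_pos)
      then show "anticlockwise_angle v w = \<theta>"
        using anticlockwise_angle_eq[of v w] \<theta>[OF S] by simp
    qed
    show "\<forall>v1 v2. reduced_basis Lm v1 v2 \<longrightarrow> anticlockwise_angle v1 v2 = 2 * pi - \<theta>"
    proof (intro allI impI)
      fix v w assume "reduced_basis Lm v w"
      then have S: "?S Lm v w"
        using reduced by blast
      then have "cross2 v w < 0"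
        using cross[OF Sm S] sgnm by (simp add: sgn_1_neg)
      then show "anticlockwise_angle v w = 2 * pi - \<theta>"
        using anticlockwise_angle_eq[of v w] \<theta>[OF S] by simp
    qed
  qed
  show ?thesis
    unfolding Let_def r_def[symmetric] \<theta>_def[symmetric]
  proof (intro conjI allI impI)
    show "\<exists>L. is_lattice L \<and> projected_invariant L = (x, y) \<and> lattice_size L = \<sigma>"
      using RI[OF Sp] PI by blast
    show "isometric L L'" if "is_lattice L \<and> projected_invariant L = (x, y) \<and> lattice_size L = \<sigma> \<and>
        is_lattice L' \<and> projected_invariant L' = (x, y) \<and> lattice_size L' = \<sigma>" for L L'
      using that isom PI by blast
    show "root_invariant L = (r12, r01, r02)"
      if "is_lattice L \<and> projected_invariant L = (x, y) \<and> lattice_size L = \<sigma>" for L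
      using that PI by blast
  qed (rule exI[of _ Lp], rule exI[of _ Lm], rule interior)
qed

end
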